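(* Let $X$ be a set, let $L$ be a sublattice of the lattice $\operatorname{Eq} X$ of equivalence relations on $X$, and let $\eta, \theta \in L$ satisfy $\eta \circ \theta = \theta \circ \eta$. Then $[\![ \eta \wedge \theta, \eta ]\!]_L^{\theta}$ is a sublattice of $[\![ \eta \wedge \theta, \eta ]\!]_L$, and the lattice $[\![ \theta, \eta \vee \theta ]\!]_L$ is isomorphic (as a lattice) to $[\![ \eta \wedge \theta, \eta ]\!]_L^{\theta}$.
   Context: For a set $X$, $\operatorname{Eq} X$ denotes the lattice of all equivalence relations on $X$ (viewed as subsets of $X^2$), ordered by inclusion $\leq$; the meet $\alpha \wedge \beta$ is the intersection $\alpha \cap \beta$ and the join $\alpha \vee \beta$ is the smallest equivalence relation containing $\alpha \cup \beta$. A sublattice $L$ of $\operatorname{Eq} X$ is a subset closed under these binary meets and joins; $L$ is not assumed to be modular. For binary relations $\alpha, \beta$ on $X$, the composition is $\alpha \circ \beta = \{(x,y) \in X^2 \mid \exists c \in X,\ (x,c) \in \alpha \text{ and } (c,y) \in \beta\}$, and $\alpha$ and $\beta$ are said to permute if $\alpha \circ \beta = \beta \circ \alpha$. For $\alpha, \beta, \theta \in L$, define the interval of $L$ $$[\![ \alpha, \beta ]\!]_L := \{\gamma \in L \mid \alpha \leq \gamma \leq \beta\},$$ and define the set of elements of this interval that permute with $\theta$, $$[\![ \alpha, \beta ]\!]_L^{\theta} := \{\gamma \in L \mid \alpha \leq \gamma \leq \beta \text{ and } \gamma \circ \theta = \theta \circ \gamma\}.$$ *)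

theory Defs
  imports "HOL-Algebra.Lattice"
begin

definition incl_order :: "'a set set \<Rightarrow> 'a set gorder" where
  "incl_order S = \<lparr>carrier = S, eq = (=), le = (\<subseteq>)\<rparr>"

definition Eq :: "'a set \<Rightarrow> ('a \<times> 'a) set gorder" where
  "Eq X = incl_order {r. equiv X r}"

text \<open>Joins and meets in the theory \<open>Lattice\<close> are chosen least upper and greatest lower bounds,
  so they are meaningful only in a lattice; hence the explicit \<open>lattice\<close> conditions below.\<close>

definition sublattice :: "'a set \<Rightarrow> ('a, 'm) gorder_scheme \<Rightarrow> bool" where
  "sublattice S M \<longleftrightarrow> lattice M \<and> S \<subseteq> carrier M \<and>
     (\<forall>x\<in>S. \<forall>y\<in>S. x \<sqinter>\<^bsub>M\<^esub> y \<in> S \<and> x \<squnion>\<^bsub>M\<^esub> y \<in> S)"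

definition lattice_iso :: "('a, 'm) gorder_scheme \<Rightarrow> ('b, 'n) gorder_scheme \<Rightarrow> ('a \<Rightarrow> 'b) set" where
  "lattice_iso M N = {f. bij_betw f (carrier M) (carrier N) \<and>
     (\<forall>x\<in>carrier M. \<forall>y\<in>carrier M.
        f (x \<sqinter>\<^bsub>M\<^esub> y) = f x \<sqinter>\<^bsub>N\<^esub> f y \<and> f (x \<squnion>\<^bsub>M\<^esub> y) = f x \<squnion>\<^bsub>N\<^esub> f y)}"

definition lattice_isomorphic :: "('a, 'm) gorder_scheme \<Rightarrow> ('b, 'n) gorder_scheme \<Rightarrow> bool" where
  "lattice_isomorphic M N \<longleftrightarrow> lattice M \<and> lattice N \<and> lattice_iso M N \<noteq> {}"

definition permute :: "('a \<times> 'a) set \<Rightarrow> ('a \<times> 'a) set \<Rightarrow> bool" where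
  "permute \<alpha> \<beta> \<longleftrightarrow> \<alpha> O \<beta> = \<beta> O \<alpha>"

definition interval :: "('a \<times> 'a) set set \<Rightarrow> ('a \<times> 'a) set \<Rightarrow> ('a \<times> 'a) set \<Rightarrow> ('a \<times> 'a) set set" where
  "interval L \<alpha> \<beta> = {\<gamma> \<in> L. \<alpha> \<subseteq> \<gamma> \<and> \<gamma> \<subseteq> \<beta>}"

definition perm_interval ::
  "('a \<times> 'a) set set \<Rightarrow> ('a \<times> 'a) set \<Rightarrow> ('a \<times> 'a) set \<Rightarrow> ('a \<times> 'a) set \<Rightarrow> ('a \<times> 'a) set set" where
  "perm_interval L \<theta> \<alpha> \<beta> = {\<gamma> \<in> L. \<alpha> \<subseteq> \<gamma> \<and> \<gamma> \<subseteq> \<beta> \<and> permute \<gamma> \<theta>}"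

lemma partial_order_incl_order: "partial_order (incl_order S)"
  by unfold_locales (auto simp: incl_order_def)

lemma Eq_greatest:
  assumes "equiv X \<alpha>" "equiv X \<beta>"
  shows "greatest (Eq X) (\<alpha> \<inter> \<beta>) (Lower (Eq X) {\<alpha>, \<beta>})"
proof -
  have "equiv X (\<alpha> \<inter> \<beta>)"
    using assms by (auto simp: equiv_def refl_on_def intro: sym_Int trans_Int)
  with assms show ?thesis
    by (auto simp: greatest_def Lower_def Eq_def incl_order_def)
qed

lemma Eq_least:
  assumes "equiv X \<alpha>" "equiv X \<beta>"
  shows "least (Eq X) (\<Inter>{r. equiv X r \<and> \<alpha> \<union> \<beta> \<subseteq> r}) (Upper (Eq X) {\<alpha>, \<beta>})"
proof -
  let ?J = "\<Inter>{r. equiv X r \<and> \<alpha> \<union> \<beta> \<subseteq> r}"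
  have full: "equiv X (X \<times> X)" "\<alpha> \<union> \<beta> \<subseteq> X \<times> X"
    using assms by (auto simp: equiv_def refl_on_def sym_def trans_def)
  have "?J \<subseteq> X \<times> X"
    using full by blast
  moreover have "refl_on X ?J"
    by (auto simp: equiv_def refl_on_def)
  moreover have "sym ?J"
    by (auto simp: equiv_def intro!: symI dest: symD)
  moreover have "trans ?J"
    by (rule transI) (auto simp: equiv_def dest: transD)
  ultimately have "equiv X ?J"
    by (simp add: equiv_def)
  with assms show ?thesis
    by (auto simp: least_def Upper_def Eq_def incl_order_def)
qed

lemma lattice_Eq: "lattice (Eq X)"
proof -
  interpret partial_order "Eq X"
    by (simp add: Eq_def partial_order_incl_order)
  have car: "carrier (Eq X) = {r. equiv X r}"
    by (simp add: Eq_def incl_order_def)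
  show ?thesis
    by unfold_locales (use Eq_least Eq_greatest car in blast)+
qed

lemma Eq_meet: "equiv X \<alpha> \<Longrightarrow> equiv X \<beta> \<Longrightarrow> \<alpha> \<sqinter>\<^bsub>Eq X\<^esub> \<beta> = \<alpha> \<inter> \<beta>"
proof -
  assume a: "equiv X \<alpha>" "equiv X \<beta>"
  interpret lattice "Eq X" by (rule lattice_Eq)
  show ?thesis
    unfolding meet_def inf_def
    using Eq_greatest[OF a] by (metis (mono_tags, lifting) greatest_unique someI)
qed

lemma Eq_join:
  "equiv X \<alpha> \<Longrightarrow> equiv X \<beta> \<Longrightarrow> \<alpha> \<squnion>\<^bsub>Eq X\<^esub> \<beta> = \<Inter>{r. equiv X r \<and> \<alpha> \<union> \<beta> \<subseteq> r}"
proof -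
  assume a: "equiv X \<alpha>" "equiv X \<beta>"
  interpret lattice "Eq X" by (rule lattice_Eq)
  show ?thesis
    unfolding join_def sup_def
    using Eq_least[OF a] by (metis (mono_tags, lifting) least_unique someI)
qed

end

theory Submission
  imports Defs
begin

text \<open>The isomorphism is \<open>\<gamma> \<mapsto> \<gamma> \<inter> \<eta>\<close>, with inverse \<open>\<delta> \<mapsto> \<delta> O \<theta>\<close>. That
  \<open>\<gamma> \<inter> \<eta>\<close> permutes with \<open>\<theta>\<close> for \<open>\<gamma> \<supseteq> \<theta>\<close>, and that the two maps are mutually inverse, are
  instances of the modular law, which holds for relational composition even though \<open>L\<close> need not
  be modular. Meets of permuting elements permute since \<open>\<delta>\<^sub>1 \<inter> \<delta>\<^sub>2\<close> is the image of
  \<open>\<delta>\<^sub>1 O \<theta> \<inter> \<delta>\<^sub>2 O \<theta>\<close>; joins permute since the join is the transitive closure of the union.\<close>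

section \<open>Meets and joins of equivalence relations\<close>

lemma carrier_incl_order: "carrier (incl_order S) = S"
  by (simp add: incl_order_def)

lemma carrier_Eq: "carrier (Eq X) = {r. equiv X r}"
  by (simp add: Eq_def carrier_incl_order)

lemma equiv_join: "equiv X \<alpha> \<Longrightarrow> equiv X \<beta> \<Longrightarrow> equiv X (\<alpha> \<squnion>\<^bsub>Eq X\<^esub> \<beta>)"
  using Eq_least[of X \<alpha> \<beta>] by (auto simp: Eq_join least_def carrier_Eq)

lemma equiv_Int: "equiv X \<alpha> \<Longrightarrow> equiv X \<beta> \<Longrightarrow> equiv X (\<alpha> \<inter> \<beta>)"
  using Eq_greatest[of X \<alpha> \<beta>] by (auto simp: greatest_def carrier_Eq)

lemma join_upper:
  assumes "equiv X \<alpha>" "equiv X \<beta>"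
  shows "\<alpha> \<subseteq> \<alpha> \<squnion>\<^bsub>Eq X\<^esub> \<beta>" "\<beta> \<subseteq> \<alpha> \<squnion>\<^bsub>Eq X\<^esub> \<beta>"
  using assms by (auto simp: Eq_join)

lemma join_least:
  assumes "equiv X \<alpha>" "equiv X \<beta>" "equiv X \<gamma>" "\<alpha> \<subseteq> \<gamma>" "\<beta> \<subseteq> \<gamma>"
  shows "\<alpha> \<squnion>\<^bsub>Eq X\<^esub> \<beta> \<subseteq> \<gamma>"
  using assms by (auto simp: Eq_join)

text \<open>The transitive closure of the union of two equivalences stays reflexive and symmetric,
  so it is an equivalence, and every transitive relation above both contains it. In this form joins
  become accessible to induction along chains.\<close>

lemma join_eq_trancl:
  assumes "equiv X \<alpha>" "equiv X \<beta>"
  shows "\<alpha> \<squnion>\<^bsub>Eq X\<^esub> \<beta> = (\<alpha> \<union> \<beta>)\<^sup>+"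
proof
  have "(\<alpha> \<union> \<beta>)\<^sup>+ \<subseteq> X \<times> X"
    by (rule trancl_subset_Sigma) (use assms in \<open>auto simp: equiv_def\<close>)
  moreover have "refl_on X ((\<alpha> \<union> \<beta>)\<^sup>+)"
    using assms by (auto simp: equiv_def refl_on_def)
  moreover have "sym ((\<alpha> \<union> \<beta>)\<^sup>+)"
    using assms by (intro sym_trancl sym_Un) (auto simp: equiv_def)
  ultimately have "equiv X ((\<alpha> \<union> \<beta>)\<^sup>+)"
    by (simp add: equiv_def)
  then show "\<alpha> \<squnion>\<^bsub>Eq X\<^esub> \<beta> \<subseteq> (\<alpha> \<union> \<beta>)\<^sup>+"
    by (rule join_least[OF assms]) auto
  have "trans (\<alpha> \<squnion>\<^bsub>Eq X\<^esub> \<beta>)"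
    using equiv_join[OF assms] by (simp add: equiv_def)
  then show "(\<alpha> \<union> \<beta>)\<^sup>+ \<subseteq> \<alpha> \<squnion>\<^bsub>Eq X\<^esub> \<beta>"
    using join_upper[OF assms] trancl_mono_subset[of "\<alpha> \<union> \<beta>" "\<alpha> \<squnion>\<^bsub>Eq X\<^esub> \<beta>"]
    by (simp add: trancl_id)
qed

section \<open>Permuting relations\<close>

lemma permuteI:
  assumes "sym \<alpha>" "sym \<beta>" "\<alpha> O \<beta> \<subseteq> \<beta> O \<alpha>"
  shows "permute \<alpha> \<beta>"
proof -
  \<comment> \<open>Converse reverses composites and fixes symmetric relations, so the converse of
    the assumed inclusion is the opposite inclusion.\<close>
  have "(\<alpha> O \<beta>)\<inverse> \<subseteq> (\<beta> O \<alpha>)\<inverse>"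
    using assms(3) by blast
  then have "\<beta> O \<alpha> \<subseteq> \<alpha> O \<beta>"
    using assms(1,2) by (simp add: converse_relcomp sym_conv_converse_eq)
  with assms(3) show ?thesis
    by (auto simp: permute_def)
qed

text \<open>A pair in the join is a chain of \<open>\<alpha>\<close>- and
  \<open>\<beta>\<close>-links; a final \<open>\<theta>\<close>-step can be moved to the front past
  one link at a time.\<close>

lemma permute_join:
  assumes "equiv X \<alpha>" "equiv X \<beta>" "equiv X \<theta>" "permute \<alpha> \<theta>" "permute \<beta> \<theta>"
  shows "permute (\<alpha> \<squnion>\<^bsub>Eq X\<^esub> \<beta>) \<theta>"
proof (rule permuteI)
  \<comment> \<open>The endpoint \<open>z\<close> is quantified inside the induction because moving
    the \<open>\<theta>\<close>-step past the last link changes its target: the induction hypothesis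
    is applied to the new target \<open>w\<close>.\<close>
  have "\<forall>z. (y, z) \<in> \<theta> \<longrightarrow> (x, z) \<in> \<theta> O (\<alpha> \<union> \<beta>)\<^sup>+" if "(x, y) \<in> (\<alpha> \<union> \<beta>)\<^sup>+" for x y
    using that
  proof (induction rule: trancl_induct)
    case (base y)
    with assms(4,5) show ?case
      unfolding permute_def by blast
  next
    case (step y y')
    show ?case
    proof (intro allI impI)
      fix z assume "(y', z) \<in> \<theta>"
      with step(2) assms(4,5) obtain w where "(y, w) \<in> \<theta>" "(w, z) \<in> \<alpha> \<union> \<beta>"
        unfolding permute_def by blast
      with step.IH show "(x, z) \<in> \<theta> O (\<alpha> \<union> \<beta>)\<^sup>+"
        by (meson relcomp.cases relcomp.relcompI trancl_into_trancl)
    qed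
  qed
  then show "(\<alpha> \<squnion>\<^bsub>Eq X\<^esub> \<beta>) O \<theta> \<subseteq> \<theta> O (\<alpha> \<squnion>\<^bsub>Eq X\<^esub> \<beta>)"
    using assms(1,2) by (auto simp: join_eq_trancl)
qed (use assms equiv_join[of X \<alpha> \<beta>] in \<open>auto simp: equiv_def\<close>)

text \<open>Commutation makes the composite symmetric, since its converse is
  \<open>\<beta> O \<alpha>\<close>, and transitive, since the two middle factors of its square can
  be exchanged. Hence the composite is itself an equivalence, and any equivalence above both factors
  contains it.\<close>

lemma join_permute:
  assumes \<alpha>: "equiv X \<alpha>" and \<beta>: "equiv X \<beta>" and "permute \<alpha> \<beta>"
  shows "\<alpha> \<squnion>\<^bsub>Eq X\<^esub> \<beta> = \<alpha> O \<beta>"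
proof
  note eqv = \<alpha>[unfolded equiv_def refl_on_def] \<beta>[unfolded equiv_def refl_on_def]
  have comm: "\<alpha> O \<beta> = \<beta> O \<alpha>"
    using assms by (simp add: permute_def)
  have "refl_on X (\<alpha> O \<beta>)" "\<alpha> O \<beta> \<subseteq> X \<times> X"
    using eqv by (auto simp: refl_on_def)
  moreover have "sym (\<alpha> O \<beta>)"
    using eqv comm by (simp add: sym_conv_converse_eq converse_relcomp)
  moreover have "trans (\<alpha> O \<beta>)"
  proof -
    have "(\<alpha> O \<beta>) O (\<alpha> O \<beta>) = (\<alpha> O \<alpha>) O (\<beta> O \<beta>)"
      using comm by (metis O_assoc)
    also have "\<dots> \<subseteq> \<alpha> O \<beta>"
      using eqv by (intro relcomp_mono trans_O_subset) auto
    finally show ?thesis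
      by (meson relcomp.relcompI subsetD transI)
  qed
  ultimately have "equiv X (\<alpha> O \<beta>)"
    by (simp add: equiv_def)
  then show "\<alpha> \<squnion>\<^bsub>Eq X\<^esub> \<beta> \<subseteq> \<alpha> O \<beta>"
    by (rule join_least[OF \<alpha> \<beta>]) (use eqv in blast)+
  show "\<alpha> O \<beta> \<subseteq> \<alpha> \<squnion>\<^bsub>Eq X\<^esub> \<beta>"
    using join_upper[OF \<alpha> \<beta>] equiv_join[OF \<alpha> \<beta>] by (auto simp: equiv_def dest: transD)
qed

section \<open>The modular law for composition\<close>

lemma permute_Int:
  assumes "equiv X \<eta>" "equiv X \<theta>" "permute \<eta> \<theta>" "equiv X \<gamma>" "\<theta> \<subseteq> \<gamma>"
  shows "permute (\<gamma> \<inter> \<eta>) \<theta>"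
proof (rule permuteI)
  show "(\<gamma> \<inter> \<eta>) O \<theta> \<subseteq> \<theta> O (\<gamma> \<inter> \<eta>)"
  proof clarify
    fix x c y assume c: "(x, c) \<in> \<gamma>" "(x, c) \<in> \<eta>" "(c, y) \<in> \<theta>"
    then obtain d where "(x, d) \<in> \<theta>" "(d, y) \<in> \<eta>"
      using \<open>permute \<eta> \<theta>\<close> unfolding permute_def by blast
    \<comment> \<open>The path \<open>d\<close>, \<open>x\<close>, \<open>c\<close>,
      \<open>y\<close> has all its links in \<open>\<gamma>\<close>: the outer two come from
      \<open>\<theta> \<subseteq> \<gamma>\<close>.\<close>
    moreover from this c have "(d, y) \<in> \<gamma>"
      using assms(4,5) unfolding equiv_def by (meson subsetD symD transD)
    ultimately show "(x, y) \<in> \<theta> O (\<gamma> \<inter> \<eta>)"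
      by blast
  qed
qed (use assms in \<open>auto simp: equiv_def intro: sym_Int\<close>)

text \<open>For \<open>\<delta> \<subseteq> \<eta>\<close> the modular law gives \<open>\<delta> O
  \<theta> \<inter> \<eta> = \<delta> O (\<theta> \<inter> \<eta>)\<close>, which collapses to
  \<open>\<delta>\<close> because
  \<open>\<eta> \<inter> \<theta> \<subseteq> \<delta>\<close>.\<close>

lemma relcomp_Int_cancel:
  assumes "equiv X \<eta>" "equiv X \<theta>" "equiv X \<delta>" "\<eta> \<inter> \<theta> \<subseteq> \<delta>" "\<delta> \<subseteq> \<eta>"
  shows "\<delta> O \<theta> \<inter> \<eta> = \<delta>"
proof
  show "\<delta> O \<theta> \<inter> \<eta> \<subseteq> \<delta>"
  proof clarify
    fix x c y assume c: "(x, c) \<in> \<delta>" "(c, y) \<in> \<theta>" "(x, y) \<in> \<eta>"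
    then have "(c, y) \<in> \<eta>"
      using assms(1,5) unfolding equiv_def by (meson subsetD symD transD)
    with c show "(x, y) \<in> \<delta>"
      using assms(3,4) unfolding equiv_def by (meson IntI subsetD transD)
  qed
  show "\<delta> \<subseteq> \<delta> O \<theta> \<inter> \<eta>"
    using assms unfolding equiv_def refl_on_def by blast
qed

text \<open>For \<open>\<theta> \<subseteq> \<gamma>\<close> the modular law gives \<open>(\<gamma>
  \<inter> \<eta>) O \<theta> = \<gamma> \<inter> (\<eta> O \<theta>)\<close>, and the upper bound
  on \<open>\<gamma>\<close> reduces the right side to \<open>\<gamma>\<close>.\<close>

lemma Int_relcomp_cancel:
  assumes "equiv X \<gamma>" "\<theta> \<subseteq> \<gamma>" "\<gamma> \<subseteq> \<eta> O \<theta>"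
  shows "(\<gamma> \<inter> \<eta>) O \<theta> = \<gamma>"
proof
  show "(\<gamma> \<inter> \<eta>) O \<theta> \<subseteq> \<gamma>"
    using assms(1,2) by (auto simp: equiv_def dest: transD)
  show "\<gamma> \<subseteq> (\<gamma> \<inter> \<eta>) O \<theta>"
  proof clarify
    fix x y assume xy: "(x, y) \<in> \<gamma>"
    then obtain c where c: "(x, c) \<in> \<eta>" "(c, y) \<in> \<theta>"
      using assms(3) by blast
    with xy have "(x, c) \<in> \<gamma>"
      using assms(1,2) unfolding equiv_def by (meson subsetD symD transD)
    with c show "(x, y) \<in> (\<gamma> \<inter> \<eta>) O \<theta>"
      by blast
  qed
qed

section \<open>Sublattices of \<open>Eq X\<close> as lattices in their own right\<close>

lemma sublattice_EqI:
  assumes "\<And>x. x \<in> A \<Longrightarrow> equiv X x"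
    and "\<And>x y. x \<in> A \<Longrightarrow> y \<in> A \<Longrightarrow> x \<inter> y \<in> A"
    and "\<And>x y. x \<in> A \<Longrightarrow> y \<in> A \<Longrightarrow> x \<squnion>\<^bsub>Eq X\<^esub> y \<in> A"
  shows "sublattice A (Eq X)"
  using assms by (auto simp: sublattice_def lattice_Eq carrier_Eq Eq_meet)

lemma sublattice_EqD:
  assumes "sublattice A (Eq X)" "x \<in> A"
  shows "equiv X x"
    and "y \<in> A \<Longrightarrow> x \<inter> y \<in> A"
    and "y \<in> A \<Longrightarrow> x \<squnion>\<^bsub>Eq X\<^esub> y \<in> A"
proof -
  have eqv: "equiv X z" if "z \<in> A" for z
    using assms that by (auto simp: sublattice_def carrier_Eq)
  then show "equiv X x" and "y \<in> A \<Longrightarrow> x \<squnion>\<^bsub>Eq X\<^esub> y \<in> A"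
    using assms by (auto simp: sublattice_def)
  show "x \<inter> y \<in> A" if "y \<in> A"
    using assms that Eq_meet[OF eqv eqv, of x y] by (metis sublattice_def)
qed

text \<open>The operations of \<open>incl_order A\<close> are bounds chosen within \<open>A\<close>.
  Closure of \<open>A\<close> puts the intersection and the join of \<open>Eq X\<close> among the
  candidates, and uniqueness of extremal bounds in a partial order identifies them with the chosen
  ones.\<close>

lemma sublattice_incl_order:
  assumes A: "sublattice A (Eq X)"
  shows "lattice (incl_order A)"
    and "\<And>x y. x \<in> A \<Longrightarrow> y \<in> A \<Longrightarrow> x \<sqinter>\<^bsub>incl_order A\<^esub> y = x \<inter> y"
    and "\<And>x y. x \<in> A \<Longrightarrow> y \<in> A \<Longrightarrow> x \<squnion>\<^bsub>incl_order A\<^esub> y = x \<squnion>\<^bsub>Eq X\<^esub> y"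
proof -
  note D = sublattice_EqD[OF A]
  interpret partial_order "incl_order A"
    by (rule partial_order_incl_order)
  have g: "greatest (incl_order A) (x \<inter> y) (Lower (incl_order A) {x, y})"
    if "x \<in> A" "y \<in> A" for x y
    using that D by (auto simp: greatest_def Lower_def incl_order_def)
  have l: "least (incl_order A) (x \<squnion>\<^bsub>Eq X\<^esub> y) (Upper (incl_order A) {x, y})"
    if xy: "x \<in> A" "y \<in> A" for x y
  proof -
    have "x \<subseteq> x \<squnion>\<^bsub>Eq X\<^esub> y" "y \<subseteq> x \<squnion>\<^bsub>Eq X\<^esub> y"
      using join_upper[of X x y] xy D(1) by auto
    moreover have "x \<squnion>\<^bsub>Eq X\<^esub> y \<subseteq> z" if "z \<in> A" "x \<subseteq> z" "y \<subseteq> z" for z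
      using join_least[of X x y z] xy that D(1) by auto
    ultimately show ?thesis
      using xy D(3) by (auto simp: least_def Upper_def incl_order_def)
  qed
  show "lattice (incl_order A)"
    by unfold_locales (use g l carrier_incl_order in blast)+
  show "x \<sqinter>\<^bsub>incl_order A\<^esub> y = x \<inter> y" if "x \<in> A" "y \<in> A" for x y
    unfolding meet_def inf_def using g[OF that] by (rule some_equality) (rule greatest_unique[OF _ g[OF that]])
  show "x \<squnion>\<^bsub>incl_order A\<^esub> y = x \<squnion>\<^bsub>Eq X\<^esub> y" if "x \<in> A" "y \<in> A" for x y
    unfolding join_def[of "incl_order A"] sup_def[of "incl_order A"]
    using l[OF that] by (rule some_equality) (rule least_unique[OF _ l[OF that]])
qed

lemma sublattice_incl_orderI:
  assumes A: "sublattice A (Eq X)" and B: "sublattice B (Eq X)" and "A \<subseteq> B"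
  shows "sublattice A (incl_order B)"
proof -
  have "x \<sqinter>\<^bsub>incl_order B\<^esub> y \<in> A" "x \<squnion>\<^bsub>incl_order B\<^esub> y \<in> A" if "x \<in> A" "y \<in> A" for x y
    using that \<open>A \<subseteq> B\<close> sublattice_incl_order(2,3)[OF B, of x y] sublattice_EqD(2,3)[OF A]
    by (auto simp: subset_iff)
  then show ?thesis
    using sublattice_incl_order(1)[OF B] \<open>A \<subseteq> B\<close> by (simp add: sublattice_def incl_order_def)
qed

text \<open>Since \<open>\<beta>\<close> is an equivalence, joins of elements below it stay below it
  by leastness.\<close>

lemma sublattice_interval:
  assumes L: "sublattice L (Eq X)" and \<beta>: "equiv X \<beta>"
  shows "sublattice (interval L \<alpha> \<beta>) (Eq X)"
proof (rule sublattice_EqI)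
  note D = sublattice_EqD[OF L]
  show "equiv X x" if "x \<in> interval L \<alpha> \<beta>" for x
    using that D by (simp add: interval_def)
  show "x \<inter> y \<in> interval L \<alpha> \<beta>" if "x \<in> interval L \<alpha> \<beta>" "y \<in> interval L \<alpha> \<beta>" for x y
    using that D by (auto simp: interval_def)
  show "x \<squnion>\<^bsub>Eq X\<^esub> y \<in> interval L \<alpha> \<beta>" if "x \<in> interval L \<alpha> \<beta>" "y \<in> interval L \<alpha> \<beta>" for x y
  proof -
    have "x \<in> L" "y \<in> L" "equiv X x" "equiv X y" "\<alpha> \<subseteq> x" "x \<subseteq> \<beta>" "y \<subseteq> \<beta>"
      using that D by (auto simp: interval_def)
    then show ?thesis
      using D(3) join_upper(1)[of X x y] join_least[of X x y \<beta>] \<beta> by (auto simp: interval_def)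
  qed
qed

lemma perm_interval_eq: "perm_interval L \<theta> \<alpha> \<beta> = {\<gamma> \<in> interval L \<alpha> \<beta>. permute \<gamma> \<theta>}"
  by (auto simp: perm_interval_def interval_def)

text \<open>The ambient interval is already closed, so only permutability has to be checked. Joins
  are covered by \<open>permute_join\<close>; meets need a detour, as composition need not
  distribute over intersection.\<close>

lemma sublattice_perm_interval:
  assumes L: "sublattice L (Eq X)" and "\<eta> \<in> L" "\<theta> \<in> L" and perm: "permute \<eta> \<theta>"
  shows "sublattice (perm_interval L \<theta> (\<eta> \<inter> \<theta>) \<eta>) (Eq X)"
proof (rule sublattice_EqI)
  let ?P = "perm_interval L \<theta> (\<eta> \<inter> \<theta>) \<eta>"
  have \<eta>: "equiv X \<eta>" and \<theta>: "equiv X \<theta>"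
    using assms by (auto intro: sublattice_EqD)
  note D = sublattice_EqD[OF sublattice_interval[OF L \<eta>, of "\<eta> \<inter> \<theta>"]]
  show eqv: "equiv X x" if "x \<in> ?P" for x
    using that by (intro D(1)) (simp add: perm_interval_eq)
  show "x \<squnion>\<^bsub>Eq X\<^esub> y \<in> ?P" if "x \<in> ?P" "y \<in> ?P" for x y
    using that D(3) permute_join[OF eqv[OF that(1)] eqv[OF that(2)] \<theta>]
    by (simp add: perm_interval_eq)
  show "x \<inter> y \<in> ?P" if "x \<in> ?P" "y \<in> ?P" for x y
  proof -
    \<comment> \<open>Each \<open>z\<close> is recovered from an equivalence above
      \<open>\<theta>\<close> by intersecting with \<open>\<eta>\<close>. The intersection of two
      such lifts is again an equivalence above \<open>\<theta>\<close>, so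
      \<open>permute_Int\<close> applies to it.\<close>
    have lift: "equiv X (z O \<theta>)" "\<theta> \<subseteq> z O \<theta>" "z O \<theta> \<inter> \<eta> = z" if "z \<in> ?P" for z
    proof -
      have z: "permute z \<theta>" "\<eta> \<inter> \<theta> \<subseteq> z" "z \<subseteq> \<eta>"
        using that by (auto simp: perm_interval_def)
      show "equiv X (z O \<theta>)" "\<theta> \<subseteq> z O \<theta>"
        using join_permute[OF eqv[OF that] \<theta>] z equiv_join[OF eqv[OF that] \<theta>]
          join_upper(2)[OF eqv[OF that] \<theta>] by auto
      show "z O \<theta> \<inter> \<eta> = z"
        using relcomp_Int_cancel[OF \<eta> \<theta> eqv[OF that]] z by simp
    qed
    have "equiv X (x O \<theta> \<inter> y O \<theta>)"
      using that lift(1) by (intro equiv_Int)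
    then have "permute ((x O \<theta> \<inter> y O \<theta>) \<inter> \<eta>) \<theta>"
      by (rule permute_Int[OF \<eta> \<theta> perm]) (use lift that in auto)
    moreover have "(x O \<theta> \<inter> y O \<theta>) \<inter> \<eta> = x \<inter> y"
      using lift(3)[OF that(1)] lift(3)[OF that(2)] by blast
    ultimately show ?thesis
      using that D(2) by (simp add: perm_interval_eq)
  qed
qed

theorem lemma1:
  fixes X :: "'a set" and L :: "('a \<times> 'a) set set" and \<eta> \<theta> :: "('a \<times> 'a) set"
  assumes "sublattice L (Eq X)"
    and "\<eta> \<in> L" and "\<theta> \<in> L"
    and "permute \<eta> \<theta>"
  shows "sublattice (perm_interval L \<theta> (\<eta> \<sqinter>\<^bsub>Eq X\<^esub> \<theta>) \<eta>)
           (incl_order (interval L (\<eta> \<sqinter>\<^bsub>Eq X\<^esub> \<theta>) \<eta>))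
       \<and> lattice_isomorphic
           (incl_order (interval L \<theta> (\<eta> \<squnion>\<^bsub>Eq X\<^esub> \<theta>)))
           (incl_order (perm_interval L \<theta> (\<eta> \<sqinter>\<^bsub>Eq X\<^esub> \<theta>) \<eta>))"
proof -
  note D = sublattice_EqD[OF assms(1)]
  have \<eta>: "equiv X \<eta>" and \<theta>: "equiv X \<theta>"
    using D(1) assms by auto
  define P where "P = perm_interval L \<theta> (\<eta> \<inter> \<theta>) \<eta>"
  define I where "I = interval L \<theta> (\<eta> O \<theta>)"
  have meet: "\<eta> \<sqinter>\<^bsub>Eq X\<^esub> \<theta> = \<eta> \<inter> \<theta>" and join: "\<eta> \<squnion>\<^bsub>Eq X\<^esub> \<theta> = \<eta> O \<theta>"
    using \<eta> \<theta> assms(4) by (simp_all add: Eq_meet join_permute)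
  have P: "sublattice P (Eq X)"
    unfolding P_def using assms by (rule sublattice_perm_interval)
  have I: "sublattice I (Eq X)"
    unfolding I_def using sublattice_interval[OF assms(1) equiv_join[OF \<eta> \<theta>], of \<theta>]
    by (simp add: join)
  have sub: "sublattice P (incl_order (interval L (\<eta> \<inter> \<theta>) \<eta>))"
    by (rule sublattice_incl_orderI[OF P sublattice_interval[OF assms(1) \<eta>]])
      (auto simp: P_def perm_interval_eq)
  let ?f = "\<lambda>\<gamma>. \<gamma> \<inter> \<eta>"
  have fP: "\<gamma> \<inter> \<eta> \<in> P" and gf: "(\<gamma> \<inter> \<eta>) O \<theta> = \<gamma>" if "\<gamma> \<in> I" for \<gamma>
  proof -
    have \<gamma>: "\<gamma> \<in> L" "equiv X \<gamma>" "\<theta> \<subseteq> \<gamma>" "\<gamma> \<subseteq> \<eta> O \<theta>"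
      using that D(1) by (auto simp: I_def interval_def)
    then show "\<gamma> \<inter> \<eta> \<in> P"
      using permute_Int[OF \<eta> \<theta> assms(4)] D(2)[OF _ assms(2)]
      by (auto simp: P_def perm_interval_def)
    show "(\<gamma> \<inter> \<eta>) O \<theta> = \<gamma>"
      using \<gamma> by (intro Int_relcomp_cancel)
  qed
  have gI: "\<delta> O \<theta> \<in> I" and fg: "\<delta> O \<theta> \<inter> \<eta> = \<delta>" if "\<delta> \<in> P" for \<delta>
  proof -
    have \<delta>: "\<delta> \<in> L" "equiv X \<delta>" "\<eta> \<inter> \<theta> \<subseteq> \<delta>" "\<delta> \<subseteq> \<eta>" "permute \<delta> \<theta>"
      using that D(1) by (auto simp: P_def perm_interval_def)
    \<comment> \<open>Permutability of \<open>\<delta>\<close> enters here: it identifies the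
      composite with a join, which lies in \<open>L\<close>.\<close>
    have "\<delta> \<squnion>\<^bsub>Eq X\<^esub> \<theta> = \<delta> O \<theta>"
      using \<delta> \<theta> by (simp add: join_permute)
    then show "\<delta> O \<theta> \<in> I"
      using D(3)[OF \<delta>(1) assms(3)] join_upper(2)[OF \<delta>(2) \<theta>] \<delta>(4) by (auto simp: I_def interval_def)
    show "\<delta> O \<theta> \<inter> \<eta> = \<delta>"
      using relcomp_Int_cancel[OF \<eta> \<theta>] \<delta> by simp
  qed
  have "bij_betw ?f I P"
    by (rule bij_betw_byWitness[where f' = "\<lambda>\<delta>. \<delta> O \<theta>"]) (use fP gf gI fg in auto)
  \<comment> \<open>Meets are preserved by set algebra, but intersection with \<open>\<eta>\<close>
    need not distribute over joins in general. The inverse map settles it: \<open>x\<close> and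
    \<open>y\<close> lie below \<open>?J O \<theta>\<close>, hence so does their join, and
    intersecting with \<open>\<eta>\<close> returns \<open>?J\<close>.\<close>
  moreover have "?f (x \<squnion>\<^bsub>Eq X\<^esub> y) = ?f x \<squnion>\<^bsub>Eq X\<^esub> ?f y" if xy: "x \<in> I" "y \<in> I" for x y
  proof
    let ?J = "?f x \<squnion>\<^bsub>Eq X\<^esub> ?f y"
    note DI = sublattice_EqD[OF I] and DP = sublattice_EqD[OF P]
    have eqv: "equiv X x" "equiv X y" "equiv X (?f x)" "equiv X (?f y)"
      using DI(1) DP(1) xy fP by auto
    have J: "?J \<in> P"
      using DP(3) fP xy by simp
    have "?f x O \<theta> \<subseteq> ?J O \<theta>" "?f y O \<theta> \<subseteq> ?J O \<theta>"
      using join_upper[OF eqv(3,4)] by blast+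
    then have "x \<squnion>\<^bsub>Eq X\<^esub> y \<subseteq> ?J O \<theta>"
      using join_least[OF eqv(1,2) DI(1)[OF gI[OF J]]] gf xy by simp
    then show "?f (x \<squnion>\<^bsub>Eq X\<^esub> y) \<subseteq> ?J"
      using fg[OF J] by blast
    show "?J \<subseteq> ?f (x \<squnion>\<^bsub>Eq X\<^esub> y)"
      by (rule join_least[OF eqv(3,4) DP(1)[OF fP[OF DI(3)[OF xy]]]])
        (use join_upper[OF eqv(1,2)] in auto)
  qed
  ultimately have "?f \<in> lattice_iso (incl_order I) (incl_order P)"
    unfolding lattice_iso_def
    using sublattice_incl_order(2,3)[OF I] sublattice_incl_order(2,3)[OF P] fP
    by (auto simp: carrier_incl_order)
  then have "lattice_isomorphic (incl_order I) (incl_order P)"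
    using sublattice_incl_order(1) I P by (auto simp: lattice_isomorphic_def)
  with sub show ?thesis
    by (simp add: meet join P_def I_def)
qed

end
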